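(* For every input multiset $D$ of item sizes and every integer $k\geq 1$, $FFk(D_k) \leq \left(1.5+\frac{1}{5k}\right) \cdot OPT(D_k) + 3\cdot k$.
   Context: In the $k$-times bin-packing problem ($k$BP), the input is a multiset $D$ of $n$ positive item sizes, a bin capacity $S>0$, and an integer $k\geq 1$; the goal is to pack the items into the fewest bins so that the sum of item sizes in each bin is at most $S$, each item appears in exactly $k$ different bins, and no bin contains two copies of the same item. $D_k := DD\ldots D$ denotes the sequence consisting of $k$ consecutive copies of $D$ (first all items of instance 1, then all items of instance 2, etc.), and $OPT(D_k)$ is the optimal number of bins for the $k$BP instance. The algorithm $FFk$ (the $k$-times version of First-Fit) processes the items of $D_k$ in this order; each item is placed into the lowest-indexed currently open bin that (a) has enough remaining capacity for it and (b) does not already contain a copy of the same item; if no such bin exists, a new bin is opened for it. $FFk(D_k)$ denotes the number of bins used by $FFk$. *)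

theory Defs
  imports Complex_Main
begin

(* Items are the positions 0..<length D of the list D (so equal sizes are
   distinct items); D ! i is the size of item i, S the bin capacity.
   A bin is the set of items it contains (no bin contains two copies of an item). *)

definition bin_load :: "real list \<Rightarrow> nat set \<Rightarrow> real" where
  "bin_load D b = (\<Sum>j\<in>b. D ! j)"

fun ff_insert :: "real list \<Rightarrow> real \<Rightarrow> nat \<Rightarrow> nat set list \<Rightarrow> nat set list" where
  "ff_insert D S i [] = [{i}]"
| "ff_insert D S i (b # bs) =
     (if i \<notin> b \<and> bin_load D b + D ! i \<le> S then insert i b # bs
      else b # ff_insert D S i bs)"

definition Dk_seq :: "real list \<Rightarrow> nat \<Rightarrow> nat list" where
  "Dk_seq D k = concat (replicate k [0..<length D])"

definition FFk_bins :: "real list \<Rightarrow> real \<Rightarrow> nat \<Rightarrow> nat set list" where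
  "FFk_bins D S k = foldl (\<lambda>bins i. ff_insert D S i bins) [] (Dk_seq D k)"

definition FFk :: "real list \<Rightarrow> real \<Rightarrow> nat \<Rightarrow> nat" where
  "FFk D S k = length (FFk_bins D S k)"

(* A feasible kBP packing into m bins: B i is the set of bins containing item i. *)
definition kbp_feasible :: "real list \<Rightarrow> real \<Rightarrow> nat \<Rightarrow> nat \<Rightarrow> bool" where
  "kbp_feasible D S k m \<longleftrightarrow>
     (\<exists>B :: nat \<Rightarrow> nat set.
        (\<forall>i < length D. B i \<subseteq> {..<m} \<and> card (B i) = k) \<and>
        (\<forall>j < m. (\<Sum>i \<in> {i. i < length D \<and> j \<in> B i}. D ! i) \<le> S))"

definition OPT :: "real list \<Rightarrow> real \<Rightarrow> nat \<Rightarrow> nat" where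
  "OPT D S k = (LEAST m. kbp_feasible D S k m)"

end

theory Submission
  imports Defs
begin

text \<open>
  Normalise the capacity to 1 and call an item big if its size exceeds 1/2. The bins opened
  while the algorithm processes one copy of \<open>D\<close> contain, at the end of that round, only items of
  this copy, so they form an ordinary First-Fit packing; by the classical weighting argument the
  bins without big items have average weight at least 1, up to a loss of 3 per round.
  With a bonus of 1/5 per big item (instead of the classical 2/5) a bin with a big item
  has weight at least 1 as soon as its load is at least 2/3.

  Call round \<open>t + 1\<close> saturated if at its end every older bin with a big item has load at least 2/3.
  In a saturated round only the big items of the last copy need the missing 1/5, and there
  are at most \<open>OPT / k\<close> of them. In an unsaturated round some older bin has room for every item of
  size at most 1/3, except for copies of its own small items, which have total size less than 1/6;
  hence all but two of the bins opened in this round contain a big item or two items larger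
  than 1/3, and there are at most \<open>3/2 OPT / k + 2\<close> of them. The theorem follows by induction on
  the rounds.
\<close>

section \<open>Weight functions and the weight of a feasible bin\<close>

text \<open>The classical First-Fit bonus for sizes up to 1/2: zero up to 1/6, linear up to 1/3,
  then constant 1/10. The extra bonus of big items is added separately, through
  \<open>excess\<close>.\<close>

definition ramp :: "real \<Rightarrow> real" where
  "ramp x = max 0 (min (1/10) (3/5 * (x - 1/6)))"

definition half_step :: "real \<Rightarrow> real" where
  "half_step x = (if x > 1/3 then 1/2 else 0)"

text \<open>If both terms are positive, \<open>a\<close> and \<open>b\<close> lie in the linear
  range between 1/6 and 1/3 and their sum exceeds 1/3, where \<open>ramp\<close> has its maximum:
  3/5 * (a + b - 1/3) <= 1/10.\<close>

lemma ramp_superadditive: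
  assumes "0 \<le> a" "0 \<le> b" "a + b \<le> 1/2"
  shows "ramp a + ramp b \<le> ramp (a + b)"
proof -
  have "ramp b = 0 \<or> ramp a = 0 \<or> (a > 1/6 \<and> b > 1/6)"
    unfolding ramp_def by argo
  then show ?thesis
  proof (elim disjE conjE)
    assume "a > 1/6" "b > 1/6"
    then have "ramp a = 3/5 * (a - 1/6)" "ramp b = 3/5 * (b - 1/6)" "ramp (a + b) = 1/10"
      using assms by (auto simp: ramp_def)
    then show ?thesis using assms by simp
  next
    assume "ramp b = 0"
    moreover have "ramp a \<le> ramp (a + b)" using assms unfolding ramp_def by argo
    ultimately show ?thesis by simp
  next
    assume "ramp a = 0"
    moreover have "ramp b \<le> ramp (a + b)" using assms unfolding ramp_def by argo
    ultimately show ?thesis by simp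
  qed
qed

lemma card_split_filter:
  assumes "finite P"
  shows "real (card P) = real (card (P - {p \<in> P. Q p})) + real (card {p \<in> P. Q p})"
  using assms by (subst card_Diff_subset) (auto simp: of_nat_diff card_mono)

lemma sum_superadditive_le:
  fixes f :: "real \<Rightarrow> real" and s :: "'a \<Rightarrow> real"
  assumes "finite B" and "\<And>i. i \<in> B \<Longrightarrow> 0 \<le> s i" and "sum s B \<le> c" and "f 0 = 0"
    and super: "\<And>a b. 0 \<le> a \<Longrightarrow> 0 \<le> b \<Longrightarrow> a + b \<le> c \<Longrightarrow> f a + f b \<le> f (a + b)"
  shows "(\<Sum>i\<in>B. f (s i)) \<le> f (sum s B)"
  using assms(1-3)
proof (induction B rule: finite_induct)
  case empty
  then show ?case using \<open>f 0 = 0\<close> by simp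
next
  case (insert i B)
  have nonneg: "0 \<le> s i" "0 \<le> sum s B" using insert.prems by (auto intro: sum_nonneg)
  have le: "s i + sum s B \<le> c" using insert by simp
  have "(\<Sum>i\<in>B. f (s i)) \<le> f (sum s B)" using insert.IH insert.prems(1) nonneg le by simp
  moreover have "f (s i) + f (sum s B) \<le> f (s i + sum s B)" using super nonneg le by simp
  ultimately have "f (s i) + (\<Sum>i\<in>B. f (s i)) \<le> f (s i + sum s B)" by linarith
  then show ?case using insert.hyps by simp
qed

text \<open>A bin has at most one item above 1/2. The others then total less than 1/2 and by
  superadditivity count like a single item, so \<open>f\<close> contributes at most
  \<open>\<mu>\<close> twice. Without such an item the linear bound suffices.\<close>

lemma feasible_bin_weight_le:
  fixes f :: "real \<Rightarrow> real" and s :: "'a \<Rightarrow> real"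
  assumes "finite B" and pos: "\<And>i. i \<in> B \<Longrightarrow> 0 \<le> s i" and load: "sum s B \<le> 1"
    and "f 0 = 0" and "0 \<le> c"
    and super: "\<And>a b. 0 \<le> a \<Longrightarrow> 0 \<le> b \<Longrightarrow> a + b \<le> 1/2 \<Longrightarrow> f a + f b \<le> f (a + b)"
    and bound: "\<And>x. f x \<le> \<mu>" and linear: "\<And>x. 0 \<le> x \<Longrightarrow> f x \<le> c * x"
    and c: "2 * \<mu> + h \<le> c"
  shows "(\<Sum>i\<in>B. f (s i) + (if s i > 1/2 then h else 0)) \<le> c"
proof (cases "\<exists>a\<in>B. s a > 1/2")
  case True
  then obtain a where a: "a \<in> B" "s a > 1/2" by blast
  let ?R = "B - {a}"
  have R: "sum s ?R < 1/2" using a load sum.remove[OF \<open>finite B\<close> a(1), of s] by simp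
  have small: "s i \<le> 1/2" if "i \<in> ?R" for i
    using member_le_sum[of i ?R s] that pos R \<open>finite B\<close> by auto
  have "(\<Sum>i\<in>?R. f (s i)) \<le> f (sum s ?R)"
    by (rule sum_superadditive_le[where c = "1/2"]) (use assms R in auto)
  then have "(\<Sum>i\<in>?R. f (s i) + (if s i > 1/2 then h else 0)) \<le> \<mu>"
    using bound[of "sum s ?R"] small by (subst sum.cong[OF refl, of _ _ "\<lambda>i. f (s i)"]) force+
  then show ?thesis
    using sum.remove[OF \<open>finite B\<close> a(1), of "\<lambda>i. f (s i) + (if s i > 1/2 then h else 0)"]
      bound[of "s a"] a c by simp
next
  case False
  then have "(\<Sum>i\<in>B. f (s i) + (if s i > 1/2 then h else 0)) = (\<Sum>i\<in>B. f (s i))"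
    by (intro sum.cong) auto
  also have "\<dots> \<le> (\<Sum>i\<in>B. c * s i)" by (intro sum_mono linear pos)
  also have "\<dots> = c * sum s B" by (simp add: sum_distrib_left)
  also have "\<dots> \<le> c" using load \<open>0 \<le> c\<close> by (simp add: mult_left_le)
  finally show ?thesis .
qed

section \<open>Bins without big items in a First-Fit packing\<close>

text \<open>Here \<open>y\<close> is the debt of an earlier bin: a load of 5/6 - y forces all later
  items above 1/6 + y, and two such items in the next bin earn a bonus of 6/5 * y. Peeling off the
  lowest bin, each bin pays the debt of its predecessor; the loss of 3 covers the bins where this
  chain ends.\<close>

lemma first_fit_weight_ge:
  fixes s :: "'a \<Rightarrow> real" and A :: "nat \<Rightarrow> 'a set" and y :: real
  assumes "finite P"
    and "\<And>p. p \<in> P \<Longrightarrow> finite (A p) \<and> A p \<noteq> {}"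
    and "\<And>p i. p \<in> P \<Longrightarrow> i \<in> A p \<Longrightarrow> 0 < s i \<and> s i \<le> 1/2"
    and "\<And>p q i. p \<in> P \<Longrightarrow> q \<in> P \<Longrightarrow> p < q \<Longrightarrow> i \<in> A q \<Longrightarrow> sum s (A p) + s i > 1"
    and "0 \<le> y" and "y \<le> 1/6"
    and "\<And>p i. 0 < y \<Longrightarrow> p \<in> P \<Longrightarrow> i \<in> A p \<Longrightarrow> s i > 1/6 + y"
  shows "(\<Sum>p\<in>P. \<Sum>i\<in>A p. 6/5 * s i + ramp (s i)) \<ge> real (card P) - 3 + 6/5 * y"
  using assms
proof (induction P arbitrary: y rule: finite_linorder_min_induct)
  case empty
  then show ?case by simp
next
  case (insert b P)
  let ?w = "\<lambda>p. \<Sum>i\<in>A p. 6/5 * s i + ramp (s i)"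
  have w_nonneg: "0 \<le> ?w p" if "p \<in> insert b P" for p
    using insert.prems(2)[OF that] by (intro sum_nonneg) (fastforce simp: ramp_def)
  have bP: "b \<notin> P" using insert.hyps by auto
  \<comment> \<open>A later item of size at most 1/2 was refused, so the bin holds more than 1/2,
    and none of its own items can do this alone.\<close>
  have two: "\<exists>i j. i \<in> A p \<and> j \<in> A p \<and> i \<noteq> j" and half: "sum s (A p) > 1/2"
    if pq: "p \<in> insert b P" "q \<in> insert b P" "p < q" for p q
  proof -
    obtain x where x: "x \<in> A q" using insert.prems(1)[OF pq(2)] by auto
    show half: "sum s (A p) > 1/2"
      using insert.prems(3)[OF pq x] insert.prems(2)[OF pq(2) x] by simp
    obtain i where i: "i \<in> A p" using insert.prems(1)[OF pq(1)] by auto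
    have "A p \<noteq> {i}" using half insert.prems(2)[OF pq(1) i] by auto
    then show "\<exists>i j. i \<in> A p \<and> j \<in> A p \<and> i \<noteq> j" using i by blast
  qed
  have pair: "(\<Sum>i\<in>A p. g i) \<ge> 2 * z"
    if pq: "p \<in> insert b P" "q \<in> insert b P" "p < q" and g: "\<And>i. i \<in> A p \<Longrightarrow> g i \<ge> z" "0 \<le> z"
    for p q and g :: "'a \<Rightarrow> real" and z
  proof -
    obtain i j where ij: "i \<in> A p" "j \<in> A p" "i \<noteq> j" using two[OF pq] by blast
    have "2 * z \<le> (\<Sum>i\<in>{i, j}. g i)" using ij g(1)[of i] g(1)[of j] by simp
    also have "\<dots> \<le> (\<Sum>i\<in>A p. g i)"
      using ij insert.prems(1)[OF pq(1)] order_trans[OF g(2) g(1)] by (intro sum_mono2) auto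
    finally show ?thesis .
  qed
  show ?case
  proof (cases "P = {}")
    case True
    then show ?thesis using w_nonneg[of b] insert.prems(5) by simp
  next
    case False
    then obtain q where q: "q \<in> P" "b < q" using insert.hyps by blast
    let ?l = "sum s (A b)"
    have "2 * (3/5 * y) \<le> (\<Sum>i\<in>A b. ramp (s i))"
      using q insert.prems(4-6) by (intro pair[of b q]) (fastforce simp: ramp_def)+
    then have wb: "?w b \<ge> 6/5 * ?l + 6/5 * y"
      by (simp add: sum.distrib sum_distrib_left)
    have IH: "(\<Sum>p\<in>P. ?w p) \<ge> real (card P) - 3 + 6/5 * z"
      if z: "0 \<le> z" "z \<le> 1/6" "\<And>p i. 0 < z \<Longrightarrow> p \<in> P \<Longrightarrow> i \<in> A p \<Longrightarrow> s i > 1/6 + z" for z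
    proof (rule insert.IH[OF _ _ _ z])
      show "finite (A p) \<and> A p \<noteq> {}" if "p \<in> P" for p
        using insert.prems(1) that by simp
      show "0 < s i \<and> s i \<le> 1/2" if "p \<in> P" "i \<in> A p" for p i
        using insert.prems(2)[of p i] that by simp
      show "sum s (A p) + s i > 1" if "p \<in> P" "q \<in> P" "p < q" "i \<in> A q" for p q i
        using insert.prems(3)[of p q i] that by simp
    qed
    have fit: "s i > 1 - ?l" if "p \<in> P" "i \<in> A p" for p i
      using insert.prems(3)[of b p i] insert.hyps that by auto
    \<comment> \<open>From 5/6 on, 6/5 times the load is already 1. Down to 2/3 the shortfall 5/6 -
      load is at most 1/6 and becomes the new \<open>y\<close>. Below 2/3 all later items exceed
      1/3.\<close>
    consider "?l \<ge> 5/6" | "2/3 \<le> ?l" "?l < 5/6" | "?l < 2/3" by linarith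
    then have "?w b + (\<Sum>p\<in>P. ?w p) \<ge> 1 + real (card P) - 3 + 6/5 * y"
    proof cases
      case 1
      then show ?thesis using IH[of 0] wb by simp
    next
      case 2
      have "(\<Sum>p\<in>P. ?w p) \<ge> real (card P) - 3 + 6/5 * (5/6 - ?l)"
        using 2 fit by (intro IH) force+
      then show ?thesis using wb by argo
    next
      case 3
      have large: "s i > 1/3" if "p \<in> P" "i \<in> A p" for p i using fit[OF that] 3 by linarith
      \<comment> \<open>Two items above 1/3 weigh at least 2 * (6/5 * 1/3 + 1/10) = 1. The last bin
        is left out, as it may hold only one item.\<close>
      have "?w p \<ge> 1" if "p \<in> P" "p \<noteq> Max P" for p
      proof -
        have "p < Max P" using that insert.hyps(1) Max_ge[of P p] by linarith
        moreover have "Max P \<in> P" using insert.hyps(1) False by simp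
        moreover have "6/5 * s i + ramp (s i) \<ge> 1/2" if "i \<in> A p" for i
          using large[OF \<open>p \<in> P\<close> that] by (simp add: ramp_def)
        ultimately have "?w p \<ge> 2 * (1/2)" using \<open>p \<in> P\<close>
          by (intro pair[of p "Max P"]) auto
        then show ?thesis by simp
      qed
      then have "(\<Sum>p\<in>P - {Max P}. ?w p) \<ge> (\<Sum>p\<in>P - {Max P}. 1)"
        by (intro sum_mono) auto
      then have "(\<Sum>p\<in>P. ?w p) \<ge> real (card P) - 1"
        using sum.remove[of P "Max P" ?w] w_nonneg[of "Max P"] False insert.hyps(1)
        by (simp add: card_Diff_singleton of_nat_diff Suc_leI card_gt_0_iff)
      then show ?thesis using wb half[of b q] q insert.prems(5) by simp
    qed
    then show ?thesis using insert.hyps bP by simp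
  qed
qed

text \<open>In the application \<open>R\<close> is what an underfilled older bin holds besides its
  big item. Of three bins p < q < r, the load of q exceeds 1/2, so q contains some z in
  \<open>R\<close>. The load of p is at most 1/2 plus its share of \<open>R\<close>, so adding z
  stays below 2/3, and p could not have refused z.\<close>

lemma first_fit_exceptional_bins:
  fixes s :: "'a \<Rightarrow> real" and A :: "nat \<Rightarrow> 'a set"
  assumes "finite P"
    and A: "\<And>p. p \<in> P \<Longrightarrow> finite (A p) \<and> A p \<noteq> {}"
    and pos: "\<And>p i. p \<in> P \<Longrightarrow> i \<in> A p \<Longrightarrow> 0 < s i \<and> s i \<le> 1/2"
    and ff: "\<And>p q i. p \<in> P \<Longrightarrow> q \<in> P \<Longrightarrow> p < q \<Longrightarrow> i \<in> A q \<Longrightarrow> sum s (A p) + s i > 1"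
    and disj: "\<And>p q. p \<in> P \<Longrightarrow> q \<in> P \<Longrightarrow> p < q \<Longrightarrow> A p \<inter> A q = {}"
    and one: "\<And>p i j. p \<in> P \<Longrightarrow> i \<in> A p \<Longrightarrow> j \<in> A p \<Longrightarrow> s i > 1/3 \<Longrightarrow> s j > 1/3 \<Longrightarrow> i = j"
    and R: "finite R" "\<And>i. i \<in> R \<Longrightarrow> 0 < s i" "sum s R < 1/6"
    and small: "\<And>p i. p \<in> P \<Longrightarrow> i \<in> A p \<Longrightarrow> s i \<le> 1/3 \<Longrightarrow> i \<in> R"
  shows "card P \<le> 2"
proof (rule ccontr)
  assume "\<not> card P \<le> 2"
  then have "3 \<le> card P" by simp
  have no_three: False if P: "p \<in> P" "q \<in> P" "r \<in> P" and "p < q" "q < r" for p q r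
  proof -
    \<comment> \<open>Items outside \<open>R\<close> exceed 1/3, so the bin has at most one of them,
      of size at most 1/2.\<close>
    have split_load: "sum s (A n) \<le> 1/2 + sum s (A n \<inter> R)" if n: "n \<in> P" for n
    proof (cases "A n \<subseteq> R")
      case True
      then show ?thesis by (simp add: Int_absorb2)
    next
      case False
      then obtain i where i: "i \<in> A n" "i \<notin> R" by blast
      then have "j \<in> R" if "j \<in> A n" "j \<noteq> i" for j
        using that small[OF n] one[OF n, of i j] by force
      then have "A n = insert i (A n \<inter> R)" using i by blast
      then have "sum s (A n) = s i + sum s (A n \<inter> R)"
        using i A[OF n] by (metis Int_iff finite_Int sum.insert)
      then show ?thesis using pos[OF n i(1)] by simp
    qed
    obtain x where x: "x \<in> A r" using A P by blast
    have "sum s (A q) > 1/2" using ff[OF P(2,3) \<open>q < r\<close> x] pos[OF P(3) x] by simp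
    then have "A q \<inter> R \<noteq> {}" using split_load[OF P(2)] by auto
    then obtain z where z: "z \<in> A q" "z \<in> R" by blast
    have "z \<notin> A p" using disj[OF P(1,2) \<open>p < q\<close>] z by blast
    then have "sum s (A p \<inter> R) + s z = sum s (insert z (A p \<inter> R))"
      using A[OF P(1)] by simp
    also have "\<dots> \<le> sum s R" using R z by (intro sum_mono2) (auto intro: less_imp_le)
    finally show False
      using ff[OF P(1,2) \<open>p < q\<close> z(1)] split_load[OF P(1)] R(3) by simp
  qed
  obtain T where "T \<subseteq> P" "card T = 3" using obtain_subset_with_card_n \<open>3 \<le> card P\<close> by metis
  then obtain a b c where "a \<in> P" "b \<in> P" "c \<in> P" "a \<noteq> b" "b \<noteq> c" "a \<noteq> c"
    by (auto simp: card_3_iff)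
  then show False using no_three by (metis linorder_neqE_nat)
qed


section \<open>Lower bounds on the optimum\<close>

text \<open>Double counting of pairs of an item and a bin containing it: every item lies in
  \<open>k\<close> bins.\<close>

lemma packing_weight_le:
  assumes feasible: "kbp_feasible D S k m"
    and bin: "\<And>b. b \<subseteq> {..<length D} \<Longrightarrow> (\<Sum>i\<in>b. D ! i) \<le> S \<Longrightarrow> sum w b \<le> c"
  shows "real k * (\<Sum>i<length D. w i) \<le> c * real m"
proof -
  let ?n = "length D"
  obtain B where B: "\<And>i. i < ?n \<Longrightarrow> B i \<subseteq> {..<m} \<and> card (B i) = k"
    and load: "\<And>j. j < m \<Longrightarrow> (\<Sum>i \<in> {i. i < ?n \<and> j \<in> B i}. D ! i) \<le> S"
    using feasible unfolding kbp_feasible_def by blast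
  have "real k * (\<Sum>i<?n. w i) = (\<Sum>i<?n. \<Sum>j\<in>B i. w i)"
    using B by (simp add: sum_distrib_left)
  also have "\<dots> = (\<Sum>i<?n. \<Sum>j\<in>{j. j < m \<and> j \<in> B i}. w i)"
    using B by (intro sum.cong refl) auto
  also have "\<dots> = (\<Sum>j<m. \<Sum>i\<in>{i. i < ?n \<and> j \<in> B i}. w i)"
    using sum.swap_restrict[of "{..<?n}" "{..<m}" "\<lambda>i j. w i" "\<lambda>i j. j \<in> B i"] by simp
  also have "\<dots> \<le> (\<Sum>j<m. c)"
    using load by (intro sum_mono bin) auto
  finally show ?thesis by (simp add: mult.commute)
qed

text \<open>A least number is attained only if some packing exists; giving every item
  \<open>k\<close> private bins is one.\<close>

lemma kbp_feasible_OPT: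
  assumes "\<forall>d \<in> set D. 0 < d \<and> d \<le> S" and "S > 0" and "k \<ge> 1"
  shows "kbp_feasible D S k (OPT D S k)"
proof -
  have "kbp_feasible D S k (length D * k)"
    unfolding kbp_feasible_def
  proof (intro exI conjI allI impI)
    fix i assume "i < length D"
    then have "Suc i * k \<le> length D * k" by (intro mult_le_mono1) simp
    then show "{i * k..<i * k + k} \<subseteq> {..<length D * k}" by auto
  next
    fix j assume j: "j < length D * k"
    have "j div k = i" if "j \<in> {i * k..<i * k + k}" for i
      using that by (intro div_nat_eqI) (auto simp: mult.commute)
    then have sub: "{i. i < length D \<and> j \<in> {i * k..<i * k + k}} \<subseteq> {j div k}" by auto
    have "j div k < length D" using j by (simp add: less_mult_imp_div_less)
    then have "(\<Sum>i\<in>{j div k}. D ! i) \<le> S" "0 \<le> D ! (j div k)" using assms by (auto simp: less_imp_le)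
    then show "(\<Sum>i\<in>{i. i < length D \<and> j \<in> {i * k..<i * k + k}}. D ! i) \<le> S"
      using sum_mono2[OF _ sub, of "\<lambda>i. D ! i"] by simp
  qed simp
  then show ?thesis unfolding OPT_def by (rule LeastI)
qed

section \<open>The First-Fit rule and the invariant of one round\<close>

text \<open>Both reasons for a refusal survive when the bin grows, so refusals at insertion time can
  be read off the bins at the end of the round.\<close>

definition rejects :: "real list \<Rightarrow> real \<Rightarrow> nat set \<Rightarrow> nat \<Rightarrow> bool" where
  "rejects D S b i \<longleftrightarrow> i \<in> b \<or> bin_load D b + D ! i > S"

lemma ff_insert_cases:
  obtains (old) p where "p < length bs" "i \<notin> bs ! p" "\<And>q. q < p \<Longrightarrow> rejects D S (bs ! q) i"
      "ff_insert D S i bs = bs[p := insert i (bs ! p)]"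
  | (new) "\<And>q. q < length bs \<Longrightarrow> rejects D S (bs ! q) i" "ff_insert D S i bs = bs @ [{i}]"
proof -
  have "(\<exists>p < length bs. i \<notin> bs ! p \<and> (\<forall>q < p. rejects D S (bs ! q) i) \<and>
          ff_insert D S i bs = bs[p := insert i (bs ! p)]) \<or>
        (\<forall>q < length bs. rejects D S (bs ! q) i) \<and> ff_insert D S i bs = bs @ [{i}]"
    (is "?old bs \<or> ?new bs")
  proof (induction bs)
    case (Cons b bs)
    show ?case
    proof (cases "rejects D S b i")
      case False
      then have "?old (b # bs)" by (intro exI[of _ 0]) (auto simp: rejects_def)
      then show ?thesis ..
    next
      case True
      then have step: "ff_insert D S i (b # bs) = b # ff_insert D S i bs"
        by (auto simp: rejects_def)
      from Cons show ?thesis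
      proof
        assume "?old bs"
        then obtain p where "p < length bs" "i \<notin> bs ! p" "\<forall>q < p. rejects D S (bs ! q) i"
          "ff_insert D S i bs = bs[p := insert i (bs ! p)]" by blast
        then have "?old (b # bs)" using True step
          by (intro exI[of _ "Suc p"]) (auto simp: nth_Cons split: nat.split)
        then show ?thesis ..
      next
        assume "?new bs"
        then have "?new (b # bs)" using True step by (auto simp: nth_Cons split: nat.split)
        then show ?thesis ..
      qed
    qed
  qed simp
  then show thesis using old new by blast
qed

text \<open>The invariant inside a round that starts with the bins \<open>bs0\<close> and has
  treated the items \<open>X\<close>. Refusals refer to the current contents of earlier bins; among
  new bins, which share no items, the reason is always capacity.\<close>

definition round_result :: "real list \<Rightarrow> real \<Rightarrow> nat set list \<Rightarrow> nat set \<Rightarrow> nat set list \<Rightarrow> bool" where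
  "round_result D S bs0 X bs \<longleftrightarrow>
     length bs0 \<le> length bs \<and>
     (\<forall>p < length bs. bs ! p \<subseteq> {..<length D}) \<and>
     (\<forall>p < length bs0. bs0 ! p \<subseteq> bs ! p) \<and>
     (\<forall>q < length bs. length bs0 \<le> q \<longrightarrow> bs ! q \<noteq> {} \<and> bs ! q \<subseteq> X \<and>
        (\<forall>p < q. \<forall>x \<in> bs ! q. rejects D S (bs ! p) x \<and> (length bs0 \<le> p \<longrightarrow> x \<notin> bs ! p)))"

lemma round_result_new:
  assumes "round_result D S bs0 X bs" "q < length bs" "length bs0 \<le> q" "p < q" "x \<in> bs ! q"
  shows "rejects D S (bs ! p) x \<and> (length bs0 \<le> p \<longrightarrow> x \<notin> bs ! p)"
  using assms unfolding round_result_def by blast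

lemma rejects_mono:
  assumes "rejects D S b i" "b \<subseteq> c" "finite c" "\<And>j. j \<in> c \<Longrightarrow> 0 \<le> D ! j"
  shows "rejects D S c i"
proof -
  have "bin_load D b \<le> bin_load D c"
    unfolding bin_load_def using assms by (intro sum_mono2) auto
  then show ?thesis using assms unfolding rejects_def by auto
qed

text \<open>The item \<open>i\<close> is fresh in this round, hence in no new bin yet; this keeps
  the new bins disjoint. Earlier refusals persist by monotonicity.\<close>

lemma round_result_ff_insert:
  assumes pos: "\<forall>d \<in> set D. 0 < d" and rr: "round_result D S bs0 X bs"
    and i: "i < length D" "i \<notin> X"
  shows "round_result D S bs0 (insert i X) (ff_insert D S i bs)"
proof -
  let ?bs = "ff_insert D S i bs"
  \<comment> \<open>The empty default just past the end lets both outcomes be described as inserting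
    \<open>i\<close> into the set at one position \<open>r\<close>.\<close>
  define old where "old = (\<lambda>q. if q < length bs then bs ! q else {})"
  obtain r where r: "r \<le> length bs" "length ?bs = max (length bs) (Suc r)"
    "\<And>q. q < r \<Longrightarrow> rejects D S (bs ! q) i"
    "\<And>q. q < length ?bs \<Longrightarrow> ?bs ! q = (if q = r then insert i (old q) else old q)"
  proof (cases rule: ff_insert_cases[of bs i D S])
    case (old p)
    then show thesis using that[of p] by (auto simp: old_def nth_list_update)
  next
    case new
    then show thesis using that[of "length bs"] by (auto simp: old_def nth_append)
  qed
  have sub: "?bs ! q \<subseteq> {..<length D}" if "q < length ?bs" for q
    using r(4)[OF that] rr i unfolding round_result_def old_def by (auto split: if_splits)
  have grow: "bs ! q \<subseteq> ?bs ! q" if "q < length bs" for q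
    using r(2) r(4)[of q] that by (auto simp: old_def)
  have mono: "rejects D S (?bs ! q) x" if "rejects D S (bs ! q) x" "q < length bs" for q x
    using that(1) grow[OF that(2)]
  proof (rule rejects_mono)
    have q: "q < length ?bs" using r(2) that by simp
    show "finite (?bs ! q)" using sub[OF q] finite_subset by blast
    show "0 \<le> D ! j" if "j \<in> ?bs ! q" for j
      using sub[OF q] that pos by (meson less_imp_le lessThan_iff nth_mem subsetD)
  qed
  have new: "?bs ! q \<noteq> {} \<and> ?bs ! q \<subseteq> insert i X \<and>
      (\<forall>p < q. \<forall>x \<in> ?bs ! q. rejects D S (?bs ! p) x \<and> (length bs0 \<le> p \<longrightarrow> x \<notin> ?bs ! p))"
    if q: "q < length ?bs" "length bs0 \<le> q" for q
  proof (intro conjI allI impI ballI)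
    have oldq: "old q \<subseteq> X" using rr q unfolding round_result_def old_def by auto
    show "?bs ! q \<subseteq> insert i X" using r(4)[OF q(1)] oldq by auto
    show "?bs ! q \<noteq> {}"
      using r(4)[OF q(1)] r(1,2) rr q unfolding round_result_def old_def by (auto split: if_splits)
    fix p x assume p: "p < q" and x: "x \<in> ?bs ! q"
    have pl: "p < length bs" using p q r(1,2) by simp
    consider "x = i" "q = r" | "x \<in> old q" using x r(4)[OF q(1)] by (auto split: if_splits)
    note xq = this
    show "rejects D S (?bs ! p) x"
      using xq
    proof cases
      case 1
      then show ?thesis using r(3) p mono pl by blast
    next
      case 2
      then show ?thesis using rr q p unfolding round_result_def old_def
        by (auto intro!: mono pl split: if_splits)
    qed
    assume p0: "length bs0 \<le> p"
    have bsp: "bs ! p \<subseteq> X" using rr p0 pl unfolding round_result_def by auto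
    have nth_p: "?bs ! p = (if p = r then insert i (bs ! p) else bs ! p)"
      using r(4)[of p] pl p q by (simp add: old_def)
    show "x \<notin> ?bs ! p"
      using xq
    proof cases
      case 1
      then show ?thesis using nth_p bsp i p by auto
    next
      case 2
      then have "x \<notin> bs ! p" "x \<in> X"
        using rr q p p0 oldq unfolding round_result_def old_def by (auto split: if_splits)
      then show ?thesis using nth_p i by auto
    qed
  qed
  have len: "length bs0 \<le> length bs" and old0: "\<forall>p < length bs0. bs0 ! p \<subseteq> bs ! p"
    using rr unfolding round_result_def by auto
  have "length bs0 \<le> length ?bs" using len r(2) by simp
  moreover have "\<forall>p < length bs0. bs0 ! p \<subseteq> ?bs ! p"
    using old0 grow len by (meson order_trans less_le_trans)
  ultimately show ?thesis unfolding round_result_def using sub new by blast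
qed

lemma round_result_foldl:
  assumes "\<forall>d \<in> set D. 0 < d" and "distinct xs" and "set xs \<subseteq> {..<length D}"
    and "\<forall>b \<in> set bs0. b \<subseteq> {..<length D}"
  shows "round_result D S bs0 (set xs) (foldl (\<lambda>bins i. ff_insert D S i bins) bs0 xs)"
  using assms(2,3)
proof (induction xs rule: rev_induct)
  case Nil
  then show ?case using assms(4) by (auto simp: round_result_def)
next
  case (snoc x xs)
  then show ?case using round_result_ff_insert[OF assms(1), of S bs0 "set xs" _ x] by simp
qed

lemma ff_insert_weight:
  assumes "\<forall>b \<in> set bs. finite b"
  shows "sum_list (map (sum w) (ff_insert D S i bs)) = sum_list (map (sum w) bs) + (w i :: real)"
  using assms by (induction bs) auto

lemma ff_insert_finite:
  assumes "\<forall>b \<in> set bs. finite b"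
  shows "\<forall>b \<in> set (ff_insert D S i bs). finite b"
  using assms by (induction bs) auto

lemma foldl_ff_insert_weight:
  fixes w :: "nat \<Rightarrow> real"
  assumes "\<forall>b \<in> set bs. finite b"
  shows "sum_list (map (sum w) (foldl (\<lambda>bins i. ff_insert D S i bins) bs xs))
       = sum_list (map (sum w) bs) + sum_list (map w xs)"
  using assms
proof (induction xs arbitrary: bs)
  case (Cons x xs)
  then show ?case
    using ff_insert_weight[OF Cons.prems] ff_insert_finite[OF Cons.prems] by simp
qed simp

lemma FFk_bins_0: "FFk_bins D S 0 = []"
  by (simp add: FFk_bins_def Dk_seq_def)

lemma FFk_bins_Suc:
  "FFk_bins D S (Suc t) = foldl (\<lambda>bins i. ff_insert D S i bins) (FFk_bins D S t) [0..<length D]"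
proof -
  have "replicate (Suc t) [0..<length D] = replicate t [0..<length D] @ [[0..<length D]]"
    by (metis replicate_append_same replicate_Suc)
  then show ?thesis by (simp add: FFk_bins_def Dk_seq_def)
qed

section \<open>The rounds of the algorithm at capacity 1\<close>

locale kbp_instance =
  fixes D :: "real list" and S :: real
  assumes S_pos: "S > 0" and D_pos: "\<forall>d \<in> set D. 0 < d"
begin

abbreviation "n \<equiv> length D"

definition s :: "nat \<Rightarrow> real" where
  "s i = D ! i / S"

abbreviation "bins t \<equiv> FFk_bins D S t"
abbreviation "N t \<equiv> FFk D S t"
abbreviation "excess h i \<equiv> (if s i > 1/2 then h else 0 :: real)"
text \<open>A big item gets 1/10 from \<open>ramp\<close> and 1/10 from \<open>excess\<close>,
  together the bonus 1/5.\<close>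

abbreviation "weight i \<equiv> 6/5 * s i + (ramp (s i) + excess (1/10) i)"
text \<open>This is 1 for big items and 1/2 for other items above 1/3, so a bin of coarse weight
  below 1 has no big item and at most one item above 1/3.\<close>

abbreviation "coarse_weight i \<equiv> half_step (s i) + excess (1/2) i"

lemma s_pos: "i < n \<Longrightarrow> 0 < s i"
  using S_pos D_pos by (simp add: s_def)

lemma sum_s: "sum s b = bin_load D b / S"
  by (simp add: s_def bin_load_def sum_divide_distrib)

lemma bins_subset: "\<forall>b \<in> set (bins t). b \<subseteq> {..<n}"
proof (induction t)
  case (Suc t)
  have "round_result D S (bins t) (set [0..<n]) (bins (Suc t))"
    unfolding FFk_bins_Suc by (rule round_result_foldl[OF D_pos _ _ Suc]) auto
  then have "\<forall>p < length (bins (Suc t)). bins (Suc t) ! p \<subseteq> {..<n}"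
    unfolding round_result_def by blast
  then show ?case by (metis in_set_conv_nth)
qed (simp add: FFk_bins_0)

lemma round_result_bins: "round_result D S (bins t) {..<n} (bins (Suc t))"
proof -
  have "round_result D S (bins t) (set [0..<n]) (bins (Suc t))"
    unfolding FFk_bins_Suc by (rule round_result_foldl[OF D_pos _ _ bins_subset]) auto
  then show ?thesis by (simp add: atLeast0LessThan)
qed

lemma bin_subset: "p < N t \<Longrightarrow> bins t ! p \<subseteq> {..<n}"
  using bins_subset nth_mem unfolding FFk_def by blast

lemma bin_finite: "p < N t \<Longrightarrow> finite (bins t ! p)"
  using bin_subset finite_subset by blast

lemma bin_s_pos: "p < N t \<Longrightarrow> i \<in> bins t ! p \<Longrightarrow> 0 < s i"
  using bin_subset s_pos by blast

lemma bins_mono: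
  assumes "t \<le> u"
  shows "N t \<le> N u \<and> (\<forall>p < N t. bins t ! p \<subseteq> bins u ! p)"
  using assms
proof (induction u rule: dec_induct)
  case (step u)
  have "N u \<le> N (Suc u)" "\<forall>p < N u. bins u ! p \<subseteq> bins (Suc u) ! p"
    using round_result_bins[of u] by (auto simp: round_result_def FFk_def)
  then show ?case using step.IH by (meson order_trans less_le_trans)
qed simp

lemma new_bin_nonempty: "N t \<le> q \<Longrightarrow> q < N (Suc t) \<Longrightarrow> bins (Suc t) ! q \<noteq> {}"
  using round_result_bins[of t] by (auto simp: round_result_def FFk_def)

text \<open>Within one round this is the ordinary First-Fit property; only a bin from an older round
  can refuse an item because of a copy.\<close>

lemma new_bin_rejected:
  assumes "N t \<le> q" "q < N (Suc t)" "p < q" "i \<in> bins (Suc t) ! q"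
  shows "i \<in> bins (Suc t) ! p \<and> p < N t \<or> sum s (bins (Suc t) ! p) + s i > 1"
proof -
  have "rejects D S (bins (Suc t) ! p) i \<and> (N t \<le> p \<longrightarrow> i \<notin> bins (Suc t) ! p)"
    using round_result_new[OF round_result_bins, of q t p i] assms by (simp add: FFk_def)
  then have "i \<in> bins (Suc t) ! p \<and> p < N t \<or> bin_load D (bins (Suc t) ! p) + D ! i > S"
    by (auto simp: rejects_def)
  then show ?thesis using S_pos unfolding sum_s s_def by (auto simp: field_simps)
qed

lemma new_bins_disjoint:
  assumes "N t \<le> p" "p < q" "q < N (Suc t)"
  shows "bins (Suc t) ! p \<inter> bins (Suc t) ! q = {}"
proof -
  have "x \<notin> bins (Suc t) ! p" if "x \<in> bins (Suc t) ! q" for x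
    using round_result_new[OF round_result_bins, of q t p x] assms that by (simp add: FFk_def)
  then show ?thesis by blast
qed

lemma total_weight: "(\<Sum>p<N t. sum w (bins t ! p)) = real t * (\<Sum>i<n. w i)"
proof -
  have "sum_list (map (sum w) (bins t)) = real t * (\<Sum>i<n. w i)"
  proof (induction t)
    case (Suc t)
    have "\<forall>b \<in> set (bins t). finite b" using bins_subset finite_subset by blast
    then show ?case
      unfolding FFk_bins_Suc
      by (simp add: foldl_ff_insert_weight Suc.IH sum_list_distinct_conv_sum_set
          atLeast0LessThan algebra_simps)
  qed (simp add: FFk_bins_0)
  then show ?thesis by (simp add: sum_list_sum_nth FFk_def atLeast0LessThan)
qed

lemma new_bins_weight_le:
  assumes "\<And>i. i < n \<Longrightarrow> 0 \<le> (w i :: real)" and "P \<subseteq> {N t..<N (Suc t)}"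
  shows "(\<Sum>p\<in>P. sum w (bins (Suc t) ! p)) \<le> (\<Sum>i<n. w i)"
proof -
  let ?C = "\<lambda>p. bins (Suc t) ! p"
  have "(\<Sum>p\<in>P. sum w (?C p)) = sum w (\<Union>p\<in>P. ?C p)"
  proof (rule sum.UNION_disjoint[symmetric])
    show "finite P" using assms(2) finite_subset by blast
    show "\<forall>p\<in>P. finite (?C p)" using assms(2) bin_finite by auto
    show "\<forall>p\<in>P. \<forall>q\<in>P. p \<noteq> q \<longrightarrow> ?C p \<inter> ?C q = {}"
    proof (intro ballI impI)
      fix p q assume "p \<in> P" "q \<in> P" "p \<noteq> q"
      then have "N t \<le> p" "p < N (Suc t)" "N t \<le> q" "q < N (Suc t)" "p < q \<or> q < p"
        using assms(2) by auto
      then show "?C p \<inter> ?C q = {}"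
        using new_bins_disjoint[of t p q] new_bins_disjoint[of t q p] by (metis Int_commute)
    qed
  qed
  also have "\<dots> \<le> (\<Sum>i<n. w i)"
  proof (intro sum_mono2)
    show "(\<Union>p\<in>P. ?C p) \<subseteq> {..<n}"
      using assms(2) bin_subset[of _ "Suc t"] by force
  qed (use assms in auto)
  finally show ?thesis .
qed

section \<open>Saturated rounds\<close>

lemma bin_weight: "sum weight b = 6/5 * sum s b + (\<Sum>i\<in>b. ramp (s i) + excess (1/10) i)"
  by (simp add: sum.distrib sum_distrib_left)

lemma big_bin_weight_ge:
  assumes "finite b" "i \<in> b" "s i > 1/2"
  shows "sum weight b \<ge> 6/5 * sum s b + 1/5"
proof -
  have "ramp (s i) + excess (1/10) i \<le> (\<Sum>i\<in>b. ramp (s i) + excess (1/10) i)"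
    using assms by (intro member_le_sum) (auto simp: ramp_def)
  then show ?thesis using assms unfolding bin_weight by (simp add: ramp_def)
qed

text \<open>The threshold 2/3 solves 6/5 * load + 1/5 = 1; a bin below it has room for every item of
  size at most 1/3.\<close>

definition saturated :: "nat \<Rightarrow> bool" where
  "saturated t \<longleftrightarrow> (\<forall>p < N t. (\<exists>i \<in> bins (Suc t) ! p. s i > 1/2) \<longrightarrow>
     sum s (bins (Suc t) ! p) \<ge> 2/3)"

text \<open>The First-Fit argument is applied to the contents at the end of the round that opened
  the bins; later rounds only add weight.\<close>

lemma round_without_big_weight_ge:
  assumes "u \<le> t"
  defines "Q \<equiv> {p \<in> {N u..<N (Suc u)}. \<forall>i \<in> bins (Suc t) ! p. s i \<le> 1/2}"
  shows "(\<Sum>p\<in>Q. sum weight (bins (Suc t) ! p)) \<ge> real (card Q) - 3"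
proof -
  let ?A = "\<lambda>p. bins (Suc u) ! p"
  have mono: "N (Suc u) \<le> N (Suc t)" "\<And>p. p < N (Suc u) \<Longrightarrow> ?A p \<subseteq> bins (Suc t) ! p"
    using bins_mono[of "Suc u" "Suc t"] assms(1) by auto
  have Q: "N u \<le> p" "p < N (Suc u)" "\<And>i. i \<in> ?A p \<Longrightarrow> s i \<le> 1/2" if "p \<in> Q" for p
    using that mono(2)[of p] unfolding Q_def by auto
  have ff: "sum s (?A p) + s i > 1" if "p \<in> Q" "q \<in> Q" "p < q" "i \<in> ?A q" for p q i
    using new_bin_rejected[of u q p i] Q[OF that(1)] Q[OF that(2)] that by auto
  have "(\<Sum>p\<in>Q. \<Sum>i\<in>?A p. 6/5 * s i + ramp (s i)) \<ge> real (card Q) - 3 + 6/5 * 0"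
  proof (rule first_fit_weight_ge)
    show "finite Q" unfolding Q_def by simp
    show "finite (?A p) \<and> ?A p \<noteq> {}" if "p \<in> Q" for p
      using Q[OF that] bin_finite new_bin_nonempty by auto
    show "0 < s i \<and> s i \<le> 1/2" if "p \<in> Q" "i \<in> ?A p" for p i
      using Q[OF that(1)] that bin_s_pos by blast
  qed (use ff in auto)
  also have "(\<Sum>p\<in>Q. \<Sum>i\<in>?A p. 6/5 * s i + ramp (s i)) \<le> (\<Sum>p\<in>Q. sum weight (bins (Suc t) ! p))"
  proof (rule sum_mono)
    fix p assume p: "p \<in> Q"
    have pt: "p < N (Suc t)" using Q(2)[OF p] mono(1) by simp
    have nonneg: "0 \<le> s i" if "i \<in> bins (Suc t) ! p" for i
      using bin_s_pos[OF pt that] by simp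
    have "(\<Sum>i\<in>?A p. 6/5 * s i + ramp (s i)) \<le> sum weight (?A p)"
      by (intro sum_mono) simp
    also have "\<dots> \<le> sum weight (bins (Suc t) ! p)"
    proof (rule sum_mono2)
      show "0 \<le> weight i" if "i \<in> bins (Suc t) ! p - ?A p" for i
        using nonneg[of i] that by (auto simp: ramp_def)
    qed (use bin_finite[OF pt] mono(2)[OF Q(2)[OF p]] in auto)
    finally show "(\<Sum>i\<in>?A p. 6/5 * s i + ramp (s i)) \<le> sum weight (bins (Suc t) ! p)" .
  qed
  finally show ?thesis by simp
qed

text \<open>The deficit \<open>d p\<close> is granted to bins with a big item: none for older bins,
  1/5 per big item for the bins of the last round.\<close>

lemma round_weight_ge:
  assumes "u \<le> t" and "\<And>p. p \<in> {N u..<N (Suc u)} \<Longrightarrow> \<exists>i \<in> bins (Suc t) ! p. s i > 1/2 \<Longrightarrow>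
      sum weight (bins (Suc t) ! p) \<ge> 1 - d p"
    and "\<And>p. p \<in> {N u..<N (Suc u)} \<Longrightarrow> 0 \<le> d p"
  shows "(\<Sum>p\<in>{N u..<N (Suc u)}. sum weight (bins (Suc t) ! p))
    \<ge> real (N (Suc u)) - real (N u) - 3 - (\<Sum>p\<in>{N u..<N (Suc u)}. d p)"
proof -
  let ?P = "{N u..<N (Suc u)}" and ?w = "\<lambda>p. sum weight (bins (Suc t) ! p)"
  let ?Q = "{p \<in> ?P. \<forall>i \<in> bins (Suc t) ! p. s i \<le> 1/2}"
  have "(\<Sum>p\<in>?P - ?Q. ?w p) \<ge> (\<Sum>p\<in>?P - ?Q. 1 - d p)"
    using assms(2) by (intro sum_mono) force
  moreover have "(\<Sum>p\<in>?P - ?Q. d p) \<le> (\<Sum>p\<in>?P. d p)"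
    using assms(3) by (intro sum_mono2) auto
  moreover have "(\<Sum>p\<in>?P. ?w p) = (\<Sum>p\<in>?P - ?Q. ?w p) + (\<Sum>p\<in>?Q. ?w p)"
    by (intro sum.subset_diff) auto
  moreover have "real (card ?P) = real (card (?P - ?Q)) + real (card ?Q)"
    by (rule card_split_filter) simp
  moreover have "real (card ?P) = real (N (Suc u)) - real (N u)"
    using bins_mono[of u "Suc u"] by (simp add: of_nat_diff)
  ultimately show ?thesis
    using round_without_big_weight_ge[OF assms(1)] by (simp add: sum_subtractf)
qed

lemma saturated_bound:
  assumes "saturated t"
  shows "real (N (Suc t)) \<le> real (Suc t) * (\<Sum>i<n. weight i) + 1/5 * (\<Sum>i<n. excess 1 i) + 3 * real (Suc t)"
proof -
  let ?C = "\<lambda>p. bins (Suc t) ! p"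
  \<comment> \<open>Every earlier round is weighed at the end of round \<open>Suc t\<close>, the
    moment to which saturation refers.\<close>
  have before: "(\<Sum>p<N u. sum weight (?C p)) \<ge> real (N u) - 3 * real u" if "u \<le> t" for u
    using that
  proof (induction u)
    case 0
    then show ?case by (simp add: FFk_def FFk_bins_0)
  next
    case (Suc u)
    have le: "N u \<le> N (Suc u)" "N (Suc u) \<le> N t" "N t \<le> N (Suc t)"
      using bins_mono Suc.prems by auto
    have "sum weight (?C p) \<ge> 1 - 0"
      if p: "p \<in> {N u..<N (Suc u)}" "\<exists>i \<in> ?C p. s i > 1/2" for p
    proof -
      have "p < N t" using p le by simp
      then have "sum s (?C p) \<ge> 2/3" using assms p(2) unfolding saturated_def by blast
      moreover have "finite (?C p)" using \<open>p < N t\<close> le by (intro bin_finite) simp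
      ultimately show ?thesis using big_bin_weight_ge[of "?C p"] p(2) by force
    qed
    then have "(\<Sum>p\<in>{N u..<N (Suc u)}. sum weight (?C p)) \<ge> real (N (Suc u)) - real (N u) - 3"
      using round_weight_ge[of u t "\<lambda>_. 0"] Suc.prems by simp
    moreover have "(\<Sum>p<N (Suc u). sum weight (?C p))
        = (\<Sum>p<N u. sum weight (?C p)) + (\<Sum>p\<in>{N u..<N (Suc u)}. sum weight (?C p))"
      unfolding atLeast0LessThan[symmetric] using le
      by (intro sum.atLeastLessThan_concat[symmetric]) auto
    ultimately show ?case using Suc.IH Suc.prems by simp
  qed
  let ?d = "\<lambda>p. 1/5 * sum (excess 1) (?C p)"
  \<comment> \<open>A big item alone brings the load above 1/2 and the weight above 6/5 * 1/2 + 1/5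
    = 4/5.\<close>
  have "sum weight (?C p) \<ge> 1 - ?d p"
    if p: "p \<in> {N t..<N (Suc t)}" "\<exists>i \<in> ?C p. s i > 1/2" for p
  proof -
    obtain i where i: "i \<in> ?C p" "s i > 1/2" using p by blast
    have fin: "finite (?C p)" using p bin_finite by simp
    have "s i \<le> sum s (?C p)"
      using i fin p bin_s_pos[of p "Suc t"] by (force intro!: member_le_sum)
    moreover have "excess 1 i \<le> sum (excess 1) (?C p)"
      by (rule member_le_sum) (use i fin in auto)
    ultimately show ?thesis using big_bin_weight_ge[OF fin i] i by simp
  qed
  then have "(\<Sum>p\<in>{N t..<N (Suc t)}. sum weight (?C p))
      \<ge> real (N (Suc t)) - real (N t) - 3 - (\<Sum>p\<in>{N t..<N (Suc t)}. ?d p)"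
    by (intro round_weight_ge) (auto intro!: sum_nonneg)
  moreover have "(\<Sum>p\<in>{N t..<N (Suc t)}. ?d p) \<le> 1/5 * (\<Sum>i<n. excess 1 i)"
    unfolding sum_distrib_left[symmetric]
    by (intro mult_left_mono new_bins_weight_le) auto
  moreover have "(\<Sum>p<N (Suc t). sum weight (?C p))
      = (\<Sum>p<N t. sum weight (?C p)) + (\<Sum>p\<in>{N t..<N (Suc t)}. sum weight (?C p))"
    unfolding atLeast0LessThan[symmetric] using bins_mono[of t "Suc t"]
    by (intro sum.atLeastLessThan_concat[symmetric]) auto
  ultimately show ?thesis using before[of t] total_weight[where w = weight and t = "Suc t"] by simp
qed

section \<open>Unsaturated rounds\<close>

lemma unsaturated_bound:
  assumes "\<not> saturated t"
  shows "real (N (Suc t)) \<le> real (N t) + (\<Sum>i<n. coarse_weight i) + 2"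
proof -
  let ?C = "\<lambda>p. bins (Suc t) ! p" and ?P = "{N t..<N (Suc t)}"
  let ?E = "{p \<in> ?P. sum coarse_weight (?C p) < 1}"
  obtain b a where b: "b < N t" "a \<in> ?C b" "s a > 1/2" "sum s (?C b) < 2/3"
    using assms unfolding saturated_def by force
  have bt: "b < N (Suc t)" using b(1) bins_mono[of t "Suc t"] by simp
  let ?R = "?C b - {a}"
  have nonneg: "0 \<le> coarse_weight i" for i by (simp add: half_step_def)
  \<comment> \<open>All new bins outside \<open>?E\<close> are paid for by coarse weight. Since
    \<open>a\<close> takes more than 1/2 of a load below 2/3, the set \<open>?R\<close> totals less
    than 1/6.\<close>
  have "card ?E \<le> 2"
  proof (rule first_fit_exceptional_bins[where s = s and A = ?C and R = ?R])
    show "finite ?E" by simp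
    show "finite ?R" using bin_finite[OF bt] by simp
    show "0 < s i" if "i \<in> ?R" for i using bin_s_pos[OF bt] that by blast
    show "sum s ?R < 1/6" using sum.remove[OF bin_finite[OF bt] b(2), of s] b(3,4) by simp
    fix p assume p: "p \<in> ?E"
    then have pN: "p < N (Suc t)" "N t \<le> p" by auto
    note fin = bin_finite[OF pN(1)]
    show "finite (?C p) \<and> ?C p \<noteq> {}" using fin new_bin_nonempty pN by blast
    show "0 < s i \<and> s i \<le> 1/2" if i: "i \<in> ?C p" for i
    proof
      show "0 < s i" by (rule bin_s_pos[OF pN(1) i])
      have "coarse_weight i < 1"
        using member_le_sum[OF i, of coarse_weight] fin nonneg p by force
      then show "s i \<le> 1/2" by (auto simp: half_step_def split: if_splits)
    qed
    show "i = j" if ij: "i \<in> ?C p" "j \<in> ?C p" "s i > 1/3" "s j > 1/3" for i j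
    proof (rule ccontr)
      assume "i \<noteq> j"
      then have "coarse_weight i + coarse_weight j = sum coarse_weight {i, j}" by simp
      also have "\<dots> \<le> sum coarse_weight (?C p)"
        using ij fin nonneg by (intro sum_mono2) auto
      also have "\<dots> < 1" using p by blast
      finally show False using ij by (auto simp: half_step_def split: if_splits)
    qed
    \<comment> \<open>Bin \<open>b\<close> has room for \<open>i\<close>, so it can have refused
      \<open>i\<close> only as a copy, and \<open>i\<close> differs from \<open>a\<close> because
      \<open>a\<close> is big.\<close>
    show "i \<in> ?R" if i: "i \<in> ?C p" "s i \<le> 1/3" for i
      using new_bin_rejected[of t p b i] pN b i by fastforce
    fix q assume q: "q \<in> ?E" and "p < q"
    then show "?C p \<inter> ?C q = {}" using new_bins_disjoint pN by simp
    show "sum s (?C p) + s i > 1" if "i \<in> ?C q" for i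
      using new_bin_rejected[of t q p i] q \<open>p < q\<close> pN that by auto
  qed
  moreover have "(\<Sum>p\<in>?P - ?E. 1) \<le> (\<Sum>p\<in>?P - ?E. sum coarse_weight (?C p))"
    by (intro sum_mono) auto
  moreover have "(\<Sum>p\<in>?P - ?E. sum coarse_weight (?C p)) \<le> (\<Sum>i<n. coarse_weight i)"
    using nonneg by (intro new_bins_weight_le) auto
  moreover have "real (card ?P) = real (card (?P - ?E)) + real (card ?E)"
    by (rule card_split_filter) simp
  moreover have "real (card ?P) = real (N (Suc t)) - real (N t)"
    using bins_mono[of t "Suc t"] by (simp add: of_nat_diff)
  ultimately show ?thesis by simp
qed

section \<open>Combining the rounds\<close>

text \<open>A saturated round is bounded directly, without the induction hypothesis, so the term for
  big items never accumulates; an unsaturated round adds at most \<open>Z\<close> + 2.\<close>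

lemma FFk_bound:
  assumes "(\<Sum>i<n. weight i) \<le> Z" and "(\<Sum>i<n. coarse_weight i) \<le> Z"
  shows "real (N t) \<le> real t * Z + 1/5 * (\<Sum>i<n. excess 1 i) + 3 * real t"
proof (induction t)
  case 0
  then show ?case by (simp add: FFk_def FFk_bins_0 sum_nonneg)
next
  case (Suc t)
  show ?case
  proof (cases "saturated t")
    case True
    have "real (Suc t) * (\<Sum>i<n. weight i) \<le> real (Suc t) * Z"
      using assms(1) by (intro mult_left_mono) auto
    then show ?thesis using saturated_bound[OF True] by linarith
  next
    case False
    then show ?thesis using unsaturated_bound[OF False] Suc.IH assms(2)
      by (simp add: algebra_simps)
  qed
qed

lemma feasible_weights_le:
  assumes b: "b \<subseteq> {..<n}" "(\<Sum>i\<in>b. D ! i) \<le> S"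
  shows "sum weight b \<le> 3/2" and "sum coarse_weight b \<le> 3/2" and "sum (excess 1) b \<le> 1"
proof -
  have fin: "finite b" using b(1) finite_subset by blast
  have pos: "0 \<le> s i" if "i \<in> b" for i using s_pos b(1) that by (force intro: less_imp_le)
  have load: "sum s b \<le> 1" using b(2) S_pos by (simp add: sum_s bin_load_def)
  have "(\<Sum>i\<in>b. ramp (s i) + (if s i > 1/2 then 1/10 else 0)) \<le> 3/10"
  proof (rule feasible_bin_weight_le[OF fin pos load, where \<mu> = "1/10"])
    show "ramp x \<le> 3/10 * x" if "0 \<le> x" for x using that unfolding ramp_def by argo
    show "ramp x \<le> 1/10" for x by (simp add: ramp_def)
  qed (use ramp_superadditive in \<open>auto simp: ramp_def\<close>)
  then show "sum weight b \<le> 3/2" unfolding bin_weight using load by simp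
  show "sum coarse_weight b \<le> 3/2"
    by (rule feasible_bin_weight_le[OF fin pos load, where \<mu> = "1/2"]) (auto simp: half_step_def)
  have "(\<Sum>i\<in>b. (\<lambda>_. 0) (s i) + (if s i > 1/2 then 1 else 0)) \<le> (1::real)"
    by (rule feasible_bin_weight_le[OF fin pos load, where \<mu> = 0]) auto
  then show "sum (excess 1) b \<le> 1" by simp
qed

end

theorem theorem2:
  fixes D :: "real list" and S :: real and k :: nat
  assumes "S > 0"
    and "\<forall>d \<in> set D. 0 < d \<and> d \<le> S"
    and "k \<ge> 1"
  shows "real (FFk D S k) \<le> (3/2 + 1 / (5 * real k)) * real (OPT D S k) + 3 * real k"
proof -
  interpret kbp_instance D S using assms by unfold_locales auto
  note opt = kbp_feasible_OPT[OF assms(2,1,3)]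
  have k: "0 < real k" using assms(3) by simp
  let ?Z = "3/2 * real (OPT D S k) / real k"
  have "(\<Sum>i<n. weight i) \<le> ?Z" "(\<Sum>i<n. coarse_weight i) \<le> ?Z"
    using packing_weight_le[OF opt feasible_weights_le(1)]
      packing_weight_le[OF opt feasible_weights_le(2)] k by (simp_all add: field_simps)
  from FFk_bound[OF this, of k]
  have "real (FFk D S k) \<le> 3/2 * real (OPT D S k) + 1/5 * (\<Sum>i<n. excess 1 i) + 3 * real k"
    using k by simp
  \<comment> \<open>The big items occupy \<open>k\<close> bins each and never share a bin; this
    gives the term 1/(5k).\<close>
  moreover have "(\<Sum>i<n. excess 1 i) \<le> real (OPT D S k) / real k"
    using packing_weight_le[OF opt feasible_weights_le(3)] k by (simp add: field_simps)
  ultimately show ?thesis by (simp add: algebra_simps)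
qed

end
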